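(* As formal power series in $x$, $D^{\mathsf{cpk}}(-1;x)=G(x)^{-1}$.
   Context: Let $\mathfrak{D}_n$ be the set of derangements of $[n]=\{1,\dots,n\}$, i.e. permutations $\pi=\pi_1\cdots\pi_n$ (one-line notation, $\pi_i=\pi(i)$) with $\pi_i\ne i$ for all $i$. For a permutation $\pi$ of $[n]$, the letter $\pi_i$ is a cyclic peak if $i<\pi_i>\pi_{\pi_i}$; let $\mathsf{cpk}(\pi)$ be the number of cyclic peaks of $\pi$. Define $D_n^{\mathsf{cpk}}(t)=\sum_{\pi\in\mathfrak{D}_n}t^{\mathsf{cpk}(\pi)}$ and $D^{\mathsf{cpk}}(t;x)=1+\sum_{n=1}^\infty D_n^{\mathsf{cpk}}(t)\frac{x^n}{n!}$. Let the (shifted) Pell numbers be defined by $g_0=1$, $g_1=0$, and $g_n=2g_{n-1}+g_{n-2}$ for $n\ge2$, and let $G(x)=\sum_{n\ge0}g_n\frac{x^n}{n!}$. *)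

theory Defs
  imports
    "HOL-Combinatorics.Permutations"
    "HOL-Computational_Algebra.Polynomial"
    "HOL-Computational_Algebra.Formal_Power_Series"
begin

definition derangements :: "nat \<Rightarrow> (nat \<Rightarrow> nat) set" where
  "derangements n = {\<pi>. \<pi> permutes {1..n} \<and> (\<forall>i\<in>{1..n}. \<pi> i \<noteq> i)}"

definition cpk :: "nat \<Rightarrow> (nat \<Rightarrow> nat) \<Rightarrow> nat" where
  "cpk n \<pi> = card {\<pi> i | i. i \<in> {1..n} \<and> i < \<pi> i \<and> \<pi> i > \<pi> (\<pi> i)}"

definition D_cpk :: "nat \<Rightarrow> rat poly" where
  "D_cpk n = (\<Sum>\<pi>\<in>derangements n. monom 1 (cpk n \<pi>))"

(* D^cpk(t;x) for a rational value t of the first variable, as a power series in x. *)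
definition D_cpk_egf :: "rat \<Rightarrow> rat fps" where
  "D_cpk_egf t = 1 + Abs_fps (\<lambda>n. if n = 0 then 0 else poly (D_cpk n) t / fact n)"

fun pell :: "nat \<Rightarrow> nat" where
  "pell 0 = 1"
| "pell (Suc 0) = 0"
| "pell (Suc (Suc n)) = 2 * pell (Suc n) + pell n"

definition pell_egf :: "rat fps" where
  "pell_egf = Abs_fps (\<lambda>n. of_nat (pell n) / fact n)"

end

theory Submission
  imports Defs
begin

text \<open>
  Inserting a new maximal letter into a cycle of a derangement leaves the number of cyclic peaks
  unchanged exactly at the two arcs adjacent to each peak and otherwise raises it by one.  With
  the additional case of a new 2-cycle this gives
  \<open>D_{n+1} = n t D_n + 2 t (1 - t) D_n' + n t D_{n-1}\<close>, that is \<open>L D = x t D\<close> for the derivation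
  \<open>L = (1 - t x) \<partial>/\<partial>x - 2 t (1 - t) \<partial>/\<partial>t\<close>.  The \<open>t\<close>-analogue \<open>E\<close> of the Pell series, with
  \<open>e_{n+2} = 2 e_{n+1} - t e_n\<close>, satisfies \<open>L E = - x t E\<close>.  Hence \<open>L (D E) = 0\<close>, which forces
  \<open>D E = 1\<close>; then put \<open>t = -1\<close>.
\<close>

section \<open>Inserting a maximal letter into a derangement\<close>

text \<open>The ground set is arbitrary because undoing a 2-cycle with the maximum deletes a letter
  \<open>a\<close> that may lie anywhere below it.\<close>

definition deranged :: "'a set \<Rightarrow> ('a \<Rightarrow> 'a) set" where
  "deranged S = {\<pi>. \<pi> permutes S \<and> (\<forall>i\<in>S. \<pi> i \<noteq> i)}"

text \<open>A cyclic peak is recorded by its preimage.\<close>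

definition peak_at :: "'a::linorder set \<Rightarrow> ('a \<Rightarrow> 'a) \<Rightarrow> 'a set" where
  "peak_at S \<pi> = {i\<in>S. i < \<pi> i \<and> \<pi> (\<pi> i) < \<pi> i}"

definition peak_poly :: "'a::linorder set \<Rightarrow> rat poly" where
  "peak_poly S = (\<Sum>\<pi>\<in>deranged S. monom 1 (card (peak_at S \<pi>)))"

lemma finite_deranged: "finite S \<Longrightarrow> finite (deranged S)"
  unfolding deranged_def by (rule finite_subset[OF _ finite_permutations]) auto

lemma finite_peak_at: "finite S \<Longrightarrow> finite (peak_at S \<pi>)"
  unfolding peak_at_def by simp

text \<open>A permutation is injective, so peak letters and their preimages are equally
  many.\<close>

lemma D_cpk_eq_peak_poly: "D_cpk n = peak_poly {1..n}"
proof -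
  have "cpk n \<pi> = card (peak_at {1..n} \<pi>)" if "\<pi> permutes {1..n}" for \<pi>
  proof -
    have "{\<pi> i | i. i \<in> {1..n} \<and> i < \<pi> i \<and> \<pi> i > \<pi> (\<pi> i)} = \<pi> ` peak_at {1..n} \<pi>"
      by (auto simp: peak_at_def)
    then show ?thesis
      using permutes_inj_on[OF that] by (simp add: cpk_def card_image)
  qed
  then show ?thesis
    unfolding D_cpk_def peak_poly_def derangements_def deranged_def
    by (intro sum.cong) auto
qed

text \<open>Composing with the transposition replaces the arc from \<open>a\<close> to
  \<open>\<sigma> a\<close> by a path through \<open>m\<close>. A member of
  \<open>deranged (S - {a})\<close> has \<open>a\<close> as its only fixed point in
  \<open>S\<close>, and it produces the 2-cycle of \<open>a\<close> and \<open>m\<close>.\<close>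

lemma bij_betw_insert_letter:
  fixes S :: "'a set"
  assumes "m \<notin> S"
  shows "bij_betw (\<lambda>(a, \<sigma>). \<sigma> \<circ> transpose a m)
           (Sigma S (\<lambda>a. deranged S \<union> deranged (S - {a}))) (deranged (insert m S))"
proof -
  have mem: "\<sigma> \<circ> transpose a m \<in> deranged (insert m S)"
    if a: "a \<in> S" and \<sigma>: "\<sigma> \<in> deranged S \<union> deranged (S - {a})" for a \<sigma>
  proof -
    have perm: "\<sigma> permutes S"
      using \<sigma> by (auto simp: deranged_def intro: permutes_subset)
    have no_fix: "\<sigma> i \<noteq> i" if "i \<in> S" "i \<noteq> a" for i
      using \<sigma> that by (auto simp: deranged_def)
    have "\<sigma> \<circ> transpose a m permutes insert m S"
      using a perm by (intro permutes_compose permutes_swap_id) (auto intro: permutes_subset)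
    moreover have "\<sigma> m = m" "\<sigma> a \<in> S"
      using perm a assms by (auto simp: permutes_not_in permutes_in_image)
    ultimately show ?thesis
      using a assms no_fix by (auto simp: deranged_def transpose_def)
  qed
  have inv_mem: "\<exists>a\<in>S. \<exists>\<sigma>\<in>deranged S \<union> deranged (S - {a}). \<pi> = \<sigma> \<circ> transpose a m"
    if \<pi>: "\<pi> \<in> deranged (insert m S)" for \<pi>
  proof -
    have perm: "\<pi> permutes insert m S" and no_fix: "\<And>i. i \<in> insert m S \<Longrightarrow> \<pi> i \<noteq> i"
      using \<pi> by (auto simp: deranged_def)
    obtain a where a: "\<pi> a = m" "a \<in> insert m S"
      using permutes_image[OF perm] by (metis imageE insertI1)
    with no_fix[of a] have aS: "a \<in> S" by auto
    define \<sigma> where "\<sigma> = \<pi> \<circ> transpose a m"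
    have "\<sigma> permutes insert m S"
      unfolding \<sigma>_def using aS perm by (intro permutes_compose permutes_swap_id) auto
    moreover have "\<sigma> m = m"
      using a by (simp add: \<sigma>_def)
    ultimately have \<sigma>S: "\<sigma> permutes S"
      by (auto intro: permutes_superset[of \<sigma> "insert m S"])
    have \<sigma>fix: "\<sigma> i \<noteq> i" if "i \<in> S" "i \<noteq> a" for i
      using no_fix[of i] that assms by (auto simp: \<sigma>_def transpose_def)
    have "\<sigma> \<in> deranged S \<union> deranged (S - {a})"
    \<comment> \<open>Since \<open>\<sigma> a\<close> is \<open>\<pi> m\<close>, the first case says
      that \<open>a\<close> and \<open>m\<close> form a 2-cycle of \<open>\<pi>\<close>.\<close>
    proof (cases "\<sigma> a = a")
      case True
      then have "\<sigma> permutes S - {a}"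
        by (intro permutes_superset[OF \<sigma>S]) auto
      then show ?thesis using \<sigma>fix by (auto simp: deranged_def)
    next
      case False
      then show ?thesis using \<sigma>S \<sigma>fix by (auto simp: deranged_def)
    qed
    moreover have "\<pi> = \<sigma> \<circ> transpose a m"
      by (simp add: \<sigma>_def comp_assoc)
    ultimately show ?thesis using aS by blast
  qed
  show ?thesis
    unfolding bij_betw_def
  proof
    show "inj_on (\<lambda>(a, \<sigma>). \<sigma> \<circ> transpose a m) (Sigma S (\<lambda>a. deranged S \<union> deranged (S - {a})))"
    proof (rule inj_onI, clarify)
      fix a \<sigma> b \<tau>
      assume a: "a \<in> S" "\<sigma> \<in> deranged S \<union> deranged (S - {a})"
        and b: "b \<in> S" "\<tau> \<in> deranged S \<union> deranged (S - {b})"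
        and eq: "\<sigma> \<circ> transpose a m = \<tau> \<circ> transpose b m"
      have "\<sigma> m = m" "\<tau> m = m"
        using a b assms by (auto simp: deranged_def permutes_not_in)
      \<comment> \<open>The insertion place is the preimage of \<open>m\<close>: both values here
        equal \<open>m\<close>.\<close>
      then have "(\<tau> \<circ> transpose b m) a = (\<tau> \<circ> transpose b m) b"
        by (metis eq comp_apply transpose_apply_first)
      moreover have "inj (\<tau> \<circ> transpose b m)"
        using mem[OF b] by (auto simp: deranged_def permutes_inj)
      ultimately have "a = b" by (rule injD[rotated])
      moreover have "\<sigma> = \<tau>"
      proof
        fix x
        show "\<sigma> x = \<tau> x"
          using fun_cong[OF eq, of "transpose a m x"] \<open>a = b\<close> by simp
      qed
      ultimately show "a = b \<and> \<sigma> = \<tau>" by simp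
    qed
    show "(\<lambda>(a, \<sigma>). \<sigma> \<circ> transpose a m) ` Sigma S (\<lambda>a. deranged S \<union> deranged (S - {a}))
        = deranged (insert m S)"
      using mem inv_mem by (fastforce simp: image_iff)
  qed
qed

text \<open>As \<open>m\<close> is largest, \<open>a\<close> becomes the preimage of a peak. If
  \<open>\<sigma> i = a\<close> with \<open>i \<noteq> a\<close>, then \<open>a\<close> is now
  followed by \<open>m\<close>, so \<open>i\<close> records no peak. All other positions keep their
  status, and \<open>m\<close> itself is no ascent.\<close>

lemma peak_at_insert_letter:
  fixes S :: "'a::linorder set"
  assumes m: "\<And>x. x \<in> S \<Longrightarrow> x < m" and a: "a \<in> S" and \<sigma>: "\<sigma> permutes S"
  shows "peak_at (insert m S) (\<sigma> \<circ> transpose a m)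
       = insert a {i \<in> peak_at S \<sigma>. i \<noteq> a \<and> \<sigma> i \<noteq> a}"
proof -
  have "m \<notin> S" using m by blast
  then have \<sigma>m: "\<sigma> m = m" using \<sigma> by (simp add: permutes_not_in)
  have \<sigma>S: "\<sigma> x \<in> S" if "x \<in> S" for x
    using that \<sigma> by (simp add: permutes_in_image)
  show ?thesis
  proof (intro set_eqI)
    fix i
    show "i \<in> peak_at (insert m S) (\<sigma> \<circ> transpose a m)
      \<longleftrightarrow> i \<in> insert a {i \<in> peak_at S \<sigma>. i \<noteq> a \<and> \<sigma> i \<noteq> a}"
      using m[OF a] m[OF \<sigma>S[OF a]] m[OF \<sigma>S, of i] \<sigma>S[of i] \<sigma>m a \<open>m \<notin> S\<close>
      by (cases "i = m"; cases "i = a"; cases "\<sigma> i = a"; cases "\<sigma> i = m")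
         (auto simp: peak_at_def transpose_def)
  qed
qed

text \<open>Each peak has two adjacent arcs, starting at its preimage and at the peak itself.
  Inserting there trades the old peak for the new one; the remaining \<open>card S - 2 * k\<close>
  places gain a peak.\<close>

lemma sum_peaks_insert_letter:
  fixes S :: "'a::linorder set"
  assumes fin: "finite S" and m: "\<And>x. x \<in> S \<Longrightarrow> x < m" and \<sigma>: "\<sigma> \<in> deranged S"
  defines "k \<equiv> card (peak_at S \<sigma>)"
  shows "(\<Sum>a\<in>S. monom 1 (card (peak_at (insert m S) (\<sigma> \<circ> transpose a m))))
       = of_nat (2 * k) * monom (1 :: rat) k + (of_nat (card S) - of_nat (2 * k)) * monom 1 (Suc k)"
proof -
  have perm: "\<sigma> permutes S" using \<sigma> by (simp add: deranged_def)
  define P where "P = peak_at S \<sigma>"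
  have finP: "finite P" using fin by (simp add: P_def finite_peak_at)
  define Q where "Q = P \<union> \<sigma> ` P"
  \<comment> \<open>A preimage of a peak is an ascent, whereas the peak letter is a descent.\<close>
  have disj: "P \<inter> \<sigma> ` P = {}" by (auto simp: P_def peak_at_def)
  have QS: "Q \<subseteq> S" using perm by (auto simp: Q_def P_def peak_at_def permutes_in_image)
  have inj: "inj \<sigma>" using perm by (rule permutes_inj)
  have cardQ: "card Q = 2 * k"
    using card_Un_disjoint[OF finP _ disj] finP card_image[OF inj_on_subset[OF inj], of P]
    by (simp add: Q_def k_def P_def)
  have card: "card (peak_at (insert m S) (\<sigma> \<circ> transpose a m)) = (if a \<in> Q then k else Suc k)"
    if a: "a \<in> S" for a
  proof -
    have eq: "peak_at (insert m S) (\<sigma> \<circ> transpose a m) = insert a {i \<in> P. i \<noteq> a \<and> \<sigma> i \<noteq> a}"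
      using peak_at_insert_letter[OF m a perm] by (simp add: P_def)
    have fin': "finite {i \<in> P. i \<noteq> a \<and> \<sigma> i \<noteq> a}" using finP by simp
    consider "a \<in> P" | j where "j \<in> P" "a = \<sigma> j" | "a \<notin> Q"
      unfolding Q_def by blast
    then show ?thesis
    proof cases
      case 1
      then have "insert a {i \<in> P. i \<noteq> a \<and> \<sigma> i \<noteq> a} = P"
        using disj by auto
      then show ?thesis using eq 1 by (simp add: Q_def k_def P_def)
    next
      case (2 j)
      then have "a \<notin> P" using disj by auto
      then have "{i \<in> P. i \<noteq> a \<and> \<sigma> i \<noteq> a} = P - {j}"
        using 2 inj by (auto dest: injD)
      moreover have "card (insert a (P - {j})) = card P"
        using \<open>a \<notin> P\<close> \<open>j \<in> P\<close> finP by (metis card_Suc_Diff1 card_insert_disjoint finite_Diff Diff_iff)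
      ultimately show ?thesis using eq 2 by (auto simp: Q_def k_def P_def)
    next
      case 3
      then have "{i \<in> P. i \<noteq> a \<and> \<sigma> i \<noteq> a} = P" "a \<notin> P"
        by (auto simp: Q_def)
      then show ?thesis using eq 3 finP by (simp add: k_def P_def)
    qed
  qed
  have "(\<Sum>a\<in>S. monom (1 :: rat) (card (peak_at (insert m S) (\<sigma> \<circ> transpose a m))))
      = (\<Sum>a\<in>S. if a \<in> Q then monom 1 k else monom 1 (Suc k))"
    by (intro sum.cong) (simp_all add: card)
  also have "\<dots> = of_nat (card Q) * monom 1 k + of_nat (card (S - Q)) * monom 1 (Suc k)"
    using fin QS by (simp add: sum.If_cases Int_absorb1 Diff_eq)
  also have "of_nat (card (S - Q)) = (of_nat (card S) - of_nat (2 * k) :: rat poly)"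
    using card_Diff_subset[OF _ QS] card_mono[OF fin QS] finite_subset[OF QS fin] cardQ
    by (simp add: of_nat_diff)
  finally show ?thesis by (simp only: cardQ)
qed

section \<open>Recurrence for the peak polynomials\<close>

lemma pderiv_sum: "pderiv (\<Sum>x\<in>A. f x) = (\<Sum>x\<in>A. pderiv (f x))"
  by (induction A rule: infinite_finite_induct) (simp_all add: pderiv_add)

text \<open>With t for \<open>[:0, 1:]\<close>, the count 2k t^k + (n - 2k) t^(k+1) equals n t t^k +
  2 t (1 - t) (t^k)'. This is linear in t^k, so it sums over all derangements; the last summand
  collects the new 2-cycles.\<close>

lemma peak_poly_insert:
  fixes S :: "'a::linorder set"
  assumes fin: "finite S" and m: "\<And>x. x \<in> S \<Longrightarrow> x < m"
  shows "peak_poly (insert m S) = of_nat (card S) * [:0, 1:] * peak_poly S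
    + 2 * [:0, 1:] * (1 - [:0, 1:]) * pderiv (peak_poly S)
    + [:0, 1:] * (\<Sum>a\<in>S. peak_poly (S - {a}))"
proof -
  let ?w = "\<lambda>a \<sigma>. monom (1 :: rat) (card (peak_at (insert m S) (\<sigma> \<circ> transpose a m)))"
  have "m \<notin> S" using m by blast
  have "peak_poly (insert m S)
      = (\<Sum>(a, \<sigma>)\<in>Sigma S (\<lambda>a. deranged S \<union> deranged (S - {a})). ?w a \<sigma>)"
    unfolding peak_poly_def
    using sum.reindex_bij_betw[OF bij_betw_insert_letter[OF \<open>m \<notin> S\<close>], symmetric]
    by (simp add: case_prod_unfold)
  also have "\<dots> = (\<Sum>a\<in>S. \<Sum>\<sigma>\<in>deranged S \<union> deranged (S - {a}). ?w a \<sigma>)"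
    using fin by (subst sum.Sigma) (auto simp: finite_deranged)
  also have "\<dots> = (\<Sum>a\<in>S. (\<Sum>\<sigma>\<in>deranged S. ?w a \<sigma>) + (\<Sum>\<sigma>\<in>deranged (S - {a}). ?w a \<sigma>))"
  proof (intro sum.cong refl sum.union_disjoint)
    fix a assume "a \<in> S"
    show "deranged S \<inter> deranged (S - {a}) = {}"
      using \<open>a \<in> S\<close> by (auto simp: deranged_def permutes_not_in)
  qed (use fin in \<open>auto simp: finite_deranged\<close>)
  also have "\<dots> = (\<Sum>a\<in>S. \<Sum>\<sigma>\<in>deranged S. ?w a \<sigma>) + (\<Sum>a\<in>S. \<Sum>\<sigma>\<in>deranged (S - {a}). ?w a \<sigma>)"
    by (rule sum.distrib)
  also have "(\<Sum>a\<in>S. \<Sum>\<sigma>\<in>deranged S. ?w a \<sigma>) = (\<Sum>\<sigma>\<in>deranged S. \<Sum>a\<in>S. ?w a \<sigma>)"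
    by (rule sum.swap)
  also have "\<dots> = (\<Sum>\<sigma>\<in>deranged S. of_nat (card S) * [:0, 1:] * monom 1 (card (peak_at S \<sigma>))
      + 2 * [:0, 1:] * (1 - [:0, 1:]) * pderiv (monom 1 (card (peak_at S \<sigma>))))"
  proof (intro sum.cong refl)
    fix \<sigma> assume \<sigma>: "\<sigma> \<in> deranged S"
    let ?k = "card (peak_at S \<sigma>)"
    have t: "monom 1 (Suc ?k) = [:0, 1:] * monom (1 :: rat) ?k"
      by (simp add: monom_Suc)
    \<comment> \<open>The Euler operator t d/dt absorbs the factor k; in this form k = 0 needs no
      exponent k - 1.\<close>
    have d: "[:0, 1:] * pderiv (monom 1 ?k) = of_nat ?k * monom (1 :: rat) ?k"
      by (cases ?k) (simp_all add: pderiv_monom of_nat_poly smult_monom flip: monom_Suc)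
    have "2 * [:0, 1:] * (1 - [:0, 1:]) * pderiv (monom (1 :: rat) ?k)
        = 2 * (1 - [:0, 1:]) * ([:0, 1:] * pderiv (monom 1 ?k))"
      by (simp only: mult_ac)
    then show "(\<Sum>a\<in>S. ?w a \<sigma>) = of_nat (card S) * [:0, 1:] * monom 1 ?k
      + 2 * [:0, 1:] * (1 - [:0, 1:]) * pderiv (monom 1 ?k)"
      using sum_peaks_insert_letter[OF fin m \<sigma>]
      unfolding t d of_nat_mult of_nat_numeral by algebra
  qed
  also have "\<dots> = of_nat (card S) * [:0, 1:] * peak_poly S
    + 2 * [:0, 1:] * (1 - [:0, 1:]) * pderiv (peak_poly S)"
    unfolding peak_poly_def pderiv_sum sum_distrib_left sum.distrib ..
  also have "(\<Sum>a\<in>S. \<Sum>\<sigma>\<in>deranged (S - {a}). ?w a \<sigma>) = [:0, 1:] * (\<Sum>a\<in>S. peak_poly (S - {a}))"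
    unfolding peak_poly_def sum_distrib_left
  proof (intro sum.cong refl)
    fix a \<sigma> assume a: "a \<in> S" and \<sigma>: "\<sigma> \<in> deranged (S - {a})"
    have permA: "\<sigma> permutes S - {a}" using \<sigma> by (simp add: deranged_def)
    then have perm: "\<sigma> permutes S" by (auto intro: permutes_subset)
    \<comment> \<open>A fixed point is neither a peak nor the preimage of one, so the new 2-cycle
      adds exactly one peak and destroys none.\<close>
    have "\<sigma> a = a" using permA by (simp add: permutes_not_in)
    then have "i = a" if "\<sigma> i = a" for i
      using that injD[OF permutes_inj[OF perm], of i a] by simp
    then have "{i \<in> peak_at S \<sigma>. i \<noteq> a \<and> \<sigma> i \<noteq> a} = peak_at (S - {a}) \<sigma>"
      by (auto simp: peak_at_def)
    then have "peak_at (insert m S) (\<sigma> \<circ> transpose a m) = insert a (peak_at (S - {a}) \<sigma>)"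
      using peak_at_insert_letter[OF m a perm] by simp
    moreover have "a \<notin> peak_at (S - {a}) \<sigma>" by (simp add: peak_at_def)
    ultimately show "?w a \<sigma> = [:0, 1:] * monom 1 (card (peak_at (S - {a}) \<sigma>))"
      using fin by (simp add: finite_peak_at monom_Suc)
  qed
  finally show ?thesis .
qed

text \<open>At \<open>n = 0\<close> the truncated index \<open>n - 1\<close> is harmless, because
  its factor \<open>of_nat n\<close> vanishes.\<close>

fun peak_rec :: "nat \<Rightarrow> rat poly" where
  "peak_rec 0 = 1"
| "peak_rec (Suc n) = of_nat n * [:0, 1:] * peak_rec n
    + 2 * [:0, 1:] * (1 - [:0, 1:]) * pderiv (peak_rec n)
    + of_nat n * [:0, 1:] * peak_rec (n - 1)"

text \<open>Removing the maximum of \<open>S\<close>, and possibly one further letter, leaves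
  smaller sets, so induction on cardinality applies.\<close>

lemma peak_poly_eq_rec:
  fixes S :: "'a::linorder set"
  assumes "finite S"
  shows "peak_poly S = peak_rec (card S)"
  using assms
proof (induction "card S" arbitrary: S rule: less_induct)
  case less
  show ?case
  proof (cases "S = {}")
    case True
    have "deranged ({} :: 'a set) = {id}" by (auto simp: deranged_def)
    then show ?thesis
      by (simp add: True peak_poly_def peak_at_def monom_0 one_pCons)
  next
    case False
    define m where "m = Max S"
    define T where "T = S - {m}"
    have m: "m \<in> S" using False less.prems by (simp add: m_def)
    have S: "S = insert m T" "finite T" "m \<notin> T" using m less.prems by (auto simp: T_def)
    have lt: "x < m" if "x \<in> T" for x
      using that less.prems by (simp add: T_def m_def order.not_eq_order_implies_strict)
    have card: "card S = Suc (card T)" using S by simp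
    have T: "peak_poly T = peak_rec (card T)" using less.hyps[of T] S(2) card by simp
    have "peak_poly (T - {a}) = peak_rec (card T - 1)" if "a \<in> T" for a
      using less.hyps[of "T - {a}"] that S(2) card card_Diff1_le[of T a] by simp
    then have "(\<Sum>a\<in>T. peak_poly (T - {a})) = of_nat (card T) * peak_rec (card T - 1)"
      by simp
    then show ?thesis
      using peak_poly_insert[OF S(2) lt] by (simp add: card T S(1)[symmetric] mult_ac)
  qed
qed

lemma D_cpk_eq_rec: "D_cpk n = peak_rec n"
  by (simp add: D_cpk_eq_peak_poly peak_poly_eq_rec)

section \<open>The inverse series\<close>

text \<open>The exponential generating function is e^x (cosh(ux) - sinh(ux)/u) with u^2 = 1 -
  t.\<close>

fun pell_poly :: "nat \<Rightarrow> rat poly" where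
  "pell_poly 0 = 1"
| "pell_poly (Suc 0) = 0"
| "pell_poly (Suc (Suc n)) = 2 * pell_poly (Suc n) - [:0, 1:] * pell_poly n"

lemma pell_poly_at_minus_one: "poly (pell_poly n) (-1) = of_nat (pell n)"
  by (induction n rule: pell.induct) auto

text \<open>This is the recurrence of \<open>peak_rec\<close> with the sign of the last term
  reversed, the source of the cancellation in the product. It follows from the three-term recurrence
  and its derivative in t.\<close>

lemma pell_poly_Suc:
  "pell_poly (Suc n) = of_nat n * [:0, 1:] * pell_poly n
    + 2 * [:0, 1:] * (1 - [:0, 1:]) * pderiv (pell_poly n)
    - of_nat n * [:0, 1:] * pell_poly (n - 1)"
proof (induction n rule: pell_poly.induct)
  case 1
  show ?case by simp
next
  case 2
  show ?case by simp
next
  case (3 n)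
  have d: "pderiv (pell_poly (Suc (Suc n)))
      = 2 * pderiv (pell_poly (Suc n)) - pell_poly n - [:0, 1:] * pderiv (pell_poly n)"
    by (simp add: pderiv_diff pderiv_mult pderiv_pCons flip: mult_2)
  \<comment> \<open>The factor \<open>of_nat n\<close> lets the three-term recurrence be used one
    index lower even at \<open>n = 0\<close>, where both sides vanish.\<close>
  have z: "of_nat n * pell_poly (Suc n)
      = of_nat n * (2 * pell_poly n - [:0, 1:] * pell_poly (n - 1))"
    by (cases n) simp_all
  have rec: "pell_poly (Suc (Suc k)) = 2 * pell_poly (Suc k) - [:0, 1:] * pell_poly k" for k
    by simp
  show ?case
    using 3 z rec[of n] rec[of "Suc n"] unfolding d diff_Suc_1 of_nat_Suc
    by algebra
qed

section \<open>Series in x over polynomials in t, and the derivation L\<close>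

definition egf :: "(nat \<Rightarrow> rat poly) \<Rightarrow> rat poly fps" where
  "egf a = Abs_fps (\<lambda>n. smult (1 / fact n) (a n))"

text \<open>This is the partial derivative in t; \<open>fps_deriv\<close> is the one in x.\<close>

definition coeff_deriv :: "rat poly fps \<Rightarrow> rat poly fps" where
  "coeff_deriv f = Abs_fps (\<lambda>n. pderiv (fps_nth f n))"

lemma coeff_deriv_mult: "coeff_deriv (f * g) = coeff_deriv f * g + f * coeff_deriv g"
  by (rule fps_ext)
     (simp add: coeff_deriv_def fps_mult_nth pderiv_sum pderiv_mult sum.distrib
       mult.commute[of _ "pderiv p" for p])

definition peak_op :: "rat poly fps \<Rightarrow> rat poly fps" where
  "peak_op f = (1 - fps_const [:0, 1:] * fps_X) * fps_deriv f
     - fps_const (2 * [:0, 1:] * (1 - [:0, 1:])) * coeff_deriv f"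

lemma peak_op_mult: "peak_op (f * g) = peak_op f * g + f * peak_op g"
  unfolding peak_op_def coeff_deriv_mult fps_deriv_mult by algebra

lemma fps_nth_peak_op:
  "fps_nth (peak_op f) n = of_nat (Suc n) * fps_nth f (Suc n) - [:0, 1:] * (of_nat n * fps_nth f n)
     - 2 * [:0, 1:] * (1 - [:0, 1:]) * pderiv (fps_nth f n)"
proof -
  have "peak_op f = fps_deriv f - fps_const [:0, 1:] * (fps_X * fps_deriv f)
     - fps_const (2 * [:0, 1:] * (1 - [:0, 1:])) * coeff_deriv f"
    by (simp only: peak_op_def left_diff_distrib mult_1_left mult.assoc)
  then show ?thesis
    by (cases n) (simp_all add: coeff_deriv_def del: mult_pCons_left mult_pCons_right)
qed

text \<open>The equation expresses (n+1) f_{n+1} through n f_n and the t-derivative of f_n. Both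
  vanish at n = 0 because f_0 is constant, and then at every later n because f_n = 0.\<close>

lemma peak_op_kernel:
  assumes "peak_op f = 0" and "fps_nth f 0 = 1"
  shows "f = 1"
proof -
  have "fps_nth f (Suc n) = 0" for n
  proof (induction n)
    case 0
    show ?case using fps_nth_peak_op[of f 0] assms by simp
  next
    case (Suc n)
    then have "of_nat (Suc (Suc n)) * fps_nth f (Suc (Suc n)) = 0"
      using fps_nth_peak_op[of f "Suc n"] assms(1) by simp
    then show ?case by (simp only: mult_eq_0_iff of_nat_eq_0_iff) simp
  qed
  then show ?thesis
    using assms(2) by (intro fps_ext) (metis fps_one_nth not0_implies_Suc)
qed

text \<open>The parameter \<open>c\<close> serves both series: it is t for the derangements and -t
  for the Pell analogue.\<close>

lemma peak_op_egf:
  assumes "\<And>n. a (Suc n) = of_nat n * [:0, 1:] * a n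
    + 2 * [:0, 1:] * (1 - [:0, 1:]) * pderiv (a n) + of_nat n * c * a (n - 1)"
  shows "peak_op (egf a) = fps_const c * fps_X * egf a"
proof (rule fps_ext)
  fix n
  let ?s = "smult (1 / fact n)"
  have s: "of_nat (Suc n) * smult (1 / fact (Suc n)) p = ?s p" for p :: "rat poly"
    by (simp add: of_nat_poly del: of_nat_Suc)
  have "fps_nth (peak_op (egf a)) n = ?s (a (Suc n)) - [:0, 1:] * (of_nat n * ?s (a n))
     - 2 * [:0, 1:] * (1 - [:0, 1:]) * ?s (pderiv (a n))"
    unfolding fps_nth_peak_op by (simp only: egf_def fps_nth_Abs_fps s pderiv_smult)
  also have "\<dots> = ?s (a (Suc n) - of_nat n * [:0, 1:] * a n
     - 2 * [:0, 1:] * (1 - [:0, 1:]) * pderiv (a n))"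
    by (simp only: smult_diff_right mult_smult_right mult_ac)
  also have "\<dots> = ?s (of_nat n * c * a (n - 1))"
    by (simp only: assms add_diff_cancel_left' add_diff_eq diff_diff_eq)
  also have "\<dots> = fps_nth (fps_const c * fps_X * egf a) n"
  proof (cases n)
    case (Suc k)
    \<comment> \<open>Cancelling the factor n against n! shifts the index, which is multiplication
      by x.\<close>
    have "smult (1 / fact (Suc k)) (of_nat (Suc k) * p) = smult (1 / fact k) p" for p :: "rat poly"
      by (simp add: of_nat_poly del: of_nat_Suc)
    then show ?thesis
      by (simp add: Suc egf_def mult.assoc del: of_nat_Suc fact_Suc)
  qed (simp add: mult.assoc)
  finally show "fps_nth (peak_op (egf a)) n = fps_nth (fps_const c * fps_X * egf a) n" .
qed

lemma egf_peak_rec_mult_pell_poly: "egf peak_rec * egf pell_poly = 1"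
proof (rule peak_op_kernel)
  have "peak_op (egf peak_rec) = fps_const [:0, 1:] * fps_X * egf peak_rec"
    by (rule peak_op_egf) (rule peak_rec.simps)
  moreover have "peak_op (egf pell_poly) = fps_const (- [:0, 1:]) * fps_X * egf pell_poly"
    by (rule peak_op_egf)
       (subst pell_poly_Suc, simp only: mult_minus_left mult_minus_right diff_conv_add_uminus)
  ultimately show "peak_op (egf peak_rec * egf pell_poly) = 0"
    unfolding peak_op_mult fps_const_neg[symmetric] by algebra
  show "fps_nth (egf peak_rec * egf pell_poly) 0 = 1"
    by (simp add: egf_def)
qed

theorem corollary13:
  shows "D_cpk_egf (-1) = inverse pell_egf"
proof -
  \<comment> \<open>At \<open>n = 0\<close> the separate summand 1 matches
    \<open>peak_rec 0\<close>.\<close>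
  have D: "fps_nth (D_cpk_egf (-1)) n = poly (fps_nth (egf peak_rec) n) (-1)" for n
    by (simp add: D_cpk_egf_def egf_def D_cpk_eq_rec)
  have G: "fps_nth pell_egf n = poly (fps_nth (egf pell_poly) n) (-1)" for n
    by (simp add: pell_egf_def egf_def pell_poly_at_minus_one)
  have "fps_nth (pell_egf * D_cpk_egf (-1)) n = fps_nth 1 n" for n
  proof -
    \<comment> \<open>Evaluation at t = -1 is a ring homomorphism, so it commutes with the finite
      convolution. It comes last because L differentiates in t.\<close>
    have "fps_nth (D_cpk_egf (-1) * pell_egf) n
        = poly (fps_nth (egf peak_rec * egf pell_poly) n) (-1)"
      by (simp add: fps_mult_nth D G poly_sum)
    then show ?thesis
      by (simp add: egf_peak_rec_mult_pell_poly mult.commute)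
  qed
  then have "pell_egf * D_cpk_egf (-1) = 1" by (rule fps_ext)
  then show ?thesis by (rule fps_inverse_unique[symmetric])
qed

end
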